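(* Let $\boldsymbol\rho_1,\dots,\boldsymbol\rho_m$ be quantum states on $\mathbb{C}^d$, $y_1,\dots,y_m\in\mathbb{R}$, let $\mathbf{M}_0$ be a $d\times d$ Hermitian matrix, let $\mathbf{H}$ be a non-zero traceless $d\times d$ Hermitian matrix, and let $$\mathbf{U}(\boldsymbol\theta)=\mathbf{U}_pe^{-i\theta_p\mathbf{H}}\cdots\mathbf{U}_1e^{-i\theta_1\mathbf{H}}\mathbf{U}_0,\qquad \boldsymbol\theta\in\mathbb{R}^p,$$ with $\mathbf{U}_0,\dots,\mathbf{U}_p\in SU(d)$ (any realization of the periodic ansatz generated by $\mathbf{H}$). Put $\mathbf{M}(\boldsymbol\theta)=\mathbf{U}(\boldsymbol\theta)^\dagger\mathbf{M}_0\mathbf{U}(\boldsymbol\theta)$ and $L(\boldsymbol\theta)=\frac1{2m}\sum_{j=1}^m(\operatorname{tr}(\boldsymbol\rho_j\mathbf{M}(\boldsymbol\theta))-y_j)^2$. Then there is a map $\Delta$ from $\mathbb{R}^p$ to the $d^2\times d^2$ Hermitian matrices such that the following holds. Let $\boldsymbol\theta(t)$ follow the gradient flow $\frac{d\boldsymbol\theta}{dt}=-\eta\nabla L(\boldsymbol\theta(t))$ with $\eta=\frac{m}{p}\frac{d^2-1}{\operatorname{tr}(\mathbf{H}^2)}$, and write $\mathbf{M}(t)=\mathbf{M}(\boldsymbol\theta(t))$, $\Delta(t)=\Delta(\boldsymbol\theta(t))$. Then the residual vector $\mathbf{r}(t)\in\mathbb{R}^m$, $r_j(t)=y_j-\operatorname{tr}(\boldsymbol\rho_j\mathbf{M}(t))$,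 satisfies $$\frac{d\mathbf{r}(t)}{dt}=-\big(\mathbf{K}_{\mathsf{asym}}(t)+\mathbf{K}_{\mathsf{pert}}(t)\big)\mathbf{r}(t),$$ where $$(\mathbf{K}_{\mathsf{asym}}(t))_{ij}=\operatorname{tr}\big(i[\mathbf{M}(t),\boldsymbol\rho_i]\;i[\mathbf{M}(t),\boldsymbol\rho_j]\big),\qquad (\mathbf{K}_{\mathsf{pert}}(t))_{ij}=\operatorname{tr}\Big(\big(i[\mathbf{M}(t),\boldsymbol\rho_i]\otimes i[\mathbf{M}(t),\boldsymbol\rho_j]\big)\,\Delta(t)\Big).$$
   Context: A quantum state on $\mathbb{C}^d$ is a positive semidefinite $d\times d$ Hermitian matrix of trace $1$. $[\mathbf A,\mathbf B]=\mathbf{AB}-\mathbf{BA}$; $\otimes$ is the Kronecker product; the factor $i$ multiplying commutators is the imaginary unit (subscripts $i,j\in\{1,\dots,m\}$ are indices). In the paper's periodic ansatz the $\mathbf{U}_l$ are sampled i.i.d. from the Haar measure on $SU(d)$; the statement concerns any fixed realization. *)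

theory Defs
  imports "HOL-Analysis.Analysis"
begin

definition mat_adj :: "complex^'n^'m \<Rightarrow> complex^'m^'n" where
  "mat_adj A = (\<chi> i j. cnj (A $ j $ i))"

definition hermitian :: "complex^'n^'n \<Rightarrow> bool" where
  "hermitian A \<longleftrightarrow> mat_adj A = A"

definition pos_semidef :: "complex^'n^'n \<Rightarrow> bool" where
  "pos_semidef A \<longleftrightarrow> hermitian A \<and> (\<forall>v. 0 \<le> Re (\<Sum>i\<in>UNIV. cnj (v $ i) * (A *v v) $ i))"

definition quantum_state :: "complex^'n^'n \<Rightarrow> bool" where
  "quantum_state \<rho> \<longleftrightarrow> pos_semidef \<rho> \<and> trace \<rho> = 1"

definition SU :: "(complex^'n^'n) set" where
  "SU = {V. V ** mat_adj V = mat 1 \<and> mat_adj V ** V = mat 1 \<and> det V = 1}"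

definition cscale :: "complex \<Rightarrow> complex^'n^'m \<Rightarrow> complex^'n^'m" where
  "cscale c A = (\<chi> i j. c * A $ i $ j)"

(* The type complex^'n^'n carries no algebra structure with product **, so the library's exp
   is not available for it. *)
definition mat_exp :: "complex^'n^'n \<Rightarrow> complex^'n^'n" where
  "mat_exp A = (\<Sum>k. (1 / fact k) *\<^sub>R (((**) A ^^ k) (mat 1)))"

definition icomm :: "complex^'n^'n \<Rightarrow> complex^'n^'n \<Rightarrow> complex^'n^'n" where
  "icomm A B = cscale \<i> (A ** B - B ** A)"

(* Rows and columns of the Kronecker product are indexed by pairs, so a d^2 x d^2 matrix has
   type complex^('d \<times> 'd)^('d \<times> 'd). *)
definition kron :: "complex^'n^'m \<Rightarrow> complex^'b^'a \<Rightarrow> complex^('n \<times> 'b)^('m \<times> 'a)" where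
  "kron A B = (\<chi> r c. A $ fst r $ fst c * B $ snd r $ snd c)"

(* The linear order on 'p provides the order of the layers: for l_1 < ... < l_p this is
   U_{l_p} e^{-i \<theta>_{l_p} H} ... U_{l_1} e^{-i \<theta>_{l_1} H} U_0. *)
definition ansatz ::
  "complex^'d^'d \<Rightarrow> complex^'d^'d \<Rightarrow> ('p::{finite,linorder} \<Rightarrow> complex^'d^'d) \<Rightarrow>
   real^'p::_ \<Rightarrow> complex^'d^'d" where
  "ansatz H U\<^sub>0 U \<theta> =
     fold (\<lambda>l V. U l ** mat_exp (cscale (- \<i> * of_real (\<theta> $ l)) H) ** V)
       (sorted_list_of_set UNIV) U\<^sub>0"

definition evolved ::
  "complex^'d^'d \<Rightarrow> complex^'d^'d \<Rightarrow> complex^'d^'d \<Rightarrow> ('p::{finite,linorder} \<Rightarrow> complex^'d^'d) \<Rightarrow>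
   real^'p::_ \<Rightarrow> complex^'d^'d" where
  "evolved M\<^sub>0 H U\<^sub>0 U \<theta> = mat_adj (ansatz H U\<^sub>0 U \<theta>) ** M\<^sub>0 ** ansatz H U\<^sub>0 U \<theta>"

(* The traces below are those of products of two Hermitian matrices; they are real
   (trace_mult_hermitian_real), so that Re only changes the type. *)

definition loss :: "('m::finite \<Rightarrow> complex^'d^'d) \<Rightarrow> real^'m \<Rightarrow> complex^'d^'d \<Rightarrow> real" where
  "loss \<rho> y M = (1 / (2 * real CARD('m))) * (\<Sum>j\<in>UNIV. (Re (trace (\<rho> j ** M)) - y $ j)\<^sup>2)"

definition residual :: "('m::finite \<Rightarrow> complex^'d^'d) \<Rightarrow> real^'m \<Rightarrow> complex^'d^'d \<Rightarrow> real^'m" where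
  "residual \<rho> y M = (\<chi> j. y $ j - Re (trace (\<rho> j ** M)))"

definition K_asym :: "('m::finite \<Rightarrow> complex^'d^'d) \<Rightarrow> complex^'d^'d \<Rightarrow> real^'m^'m" where
  "K_asym \<rho> M = (\<chi> i j. Re (trace (icomm M (\<rho> i) ** icomm M (\<rho> j))))"

definition K_pert ::
  "('m::finite \<Rightarrow> complex^'d^'d) \<Rightarrow> complex^'d^'d \<Rightarrow> complex^('d \<times> 'd)^('d \<times> 'd) \<Rightarrow> real^'m^'m" where
  "K_pert \<rho> M D = (\<chi> i j. Re (trace (kron (icomm M (\<rho> i)) (icomm M (\<rho> j)) ** D)))"

definition gradient :: "('a::real_inner \<Rightarrow> real) \<Rightarrow> 'a \<Rightarrow> 'a" where
  "gradient f x = (THE g. GDERIV f x :> g)"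

definition gradient_flow :: "real \<Rightarrow> ('a::real_inner \<Rightarrow> real) \<Rightarrow> (real \<Rightarrow> 'a) \<Rightarrow> bool" where
  "gradient_flow \<eta> f x \<longleftrightarrow>
     (\<forall>t\<ge>0. (x has_vector_derivative - (\<eta> *\<^sub>R gradient f (x t))) (at t within {0..}))"

lemma hermitian_component: "hermitian A \<Longrightarrow> cnj (A $ j $ i) = A $ i $ j"
  by (drule arg_cong[of _ _ "\<lambda>X. X $ i $ j", OF iffD1[OF hermitian_def]]) (simp add: mat_adj_def)

lemma trace_mult_hermitian_real:
  assumes "hermitian A" "hermitian B"
  shows "trace (A ** B) \<in> \<real>"
proof -
  have "cnj (trace (A ** B)) = (\<Sum>i\<in>UNIV. \<Sum>k\<in>UNIV. A $ k $ i * B $ i $ k)"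
    using assms by (simp add: trace_def matrix_matrix_mult_def hermitian_component)
  also have "\<dots> = trace (A ** B)"
    by (subst sum.swap) (simp add: trace_def matrix_matrix_mult_def)
  finally show ?thesis
    by (simp add: Reals_cnj_iff)
qed

lemma hermitian_icomm:
  assumes "hermitian A" "hermitian B"
  shows "hermitian (icomm A B)"
proof -
  have "cnj ((A ** B) $ j $ i) = (B ** A) $ i $ j" for i j
    using assms by (simp add: matrix_matrix_mult_def hermitian_component mult.commute)
  moreover have "cnj ((B ** A) $ j $ i) = (A ** B) $ i $ j" for i j
    using assms by (simp add: matrix_matrix_mult_def hermitian_component mult.commute)
  ultimately show ?thesis
    unfolding hermitian_def mat_adj_def icomm_def cscale_def vec_eq_iff by (simp add: algebra_simps)
qed

lemma hermitian_kron:
  assumes "hermitian A" "hermitian B"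
  shows "hermitian (kron A B)"
  unfolding hermitian_def mat_adj_def kron_def vec_eq_iff
  using assms by (simp add: hermitian_component)

lemma mat_adj_mult: "mat_adj (A ** B) = mat_adj B ** mat_adj A"
  by (simp add: mat_adj_def vec_eq_iff matrix_matrix_mult_def mult.commute)

lemma mat_adj_mat_adj: "mat_adj (mat_adj A) = A"
  by (simp add: mat_adj_def vec_eq_iff)

lemma hermitian_evolved: "hermitian M\<^sub>0 \<Longrightarrow> hermitian (evolved M\<^sub>0 H U\<^sub>0 U \<theta>)"
  by (simp add: hermitian_def evolved_def mat_adj_mult mat_adj_mat_adj matrix_mul_assoc)

end

theory Submission
  imports Defs
begin

text \<open>Moving the generator of layer \<open>l\<close> through the unitary circuit gives
  \<open>\<partial>\<^sub>l M = i[G\<^sub>l, M]\<close> with \<open>G\<^sub>l\<close> a unitary conjugate of \<open>H\<close>, so by cyclicity of the trace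
  \<open>\<partial>\<^sub>l tr (\<rho>\<^sub>j M) = tr (C\<^sub>j G\<^sub>l)\<close> with \<open>C\<^sub>j = i[M, \<rho>\<^sub>j]\<close>. Along the gradient flow the kernel of the
  residual dynamics is therefore
  \<open>(\<eta>/m) \<Sum>\<^sub>l tr (C\<^sub>i G\<^sub>l) tr (C\<^sub>j G\<^sub>l) = tr ((C\<^sub>i \<otimes> C\<^sub>j) (\<eta>/m) \<Sum>\<^sub>l G\<^sub>l \<otimes> G\<^sub>l)\<close>,
  and subtracting the swap operator from \<open>(\<eta>/m) \<Sum>\<^sub>l G\<^sub>l \<otimes> G\<^sub>l\<close> subtracts \<open>tr (C\<^sub>i C\<^sub>j)\<close>.\<close>

section \<open>Scaling, adjoints and boundedness of matrix operations\<close>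

lemma cscale_mult_left: "cscale c A ** B = cscale c (A ** B)"
  by (simp add: cscale_def matrix_matrix_mult_def vec_eq_iff sum_distrib_left mult.assoc)

lemma cscale_mult_right: "A ** cscale c B = cscale c (A ** B)"
  by (simp add: cscale_def matrix_matrix_mult_def vec_eq_iff sum_distrib_left mult.left_commute)

lemma cscale_add: "cscale c (A + B) = cscale c A + cscale c B"
  by (simp add: cscale_def vec_eq_iff algebra_simps)

lemma cscale_scaleR: "cscale c (r *\<^sub>R A) = r *\<^sub>R cscale c A"
  by (simp add: cscale_def vec_eq_iff)

lemma scaleR_eq_cscale: "r *\<^sub>R A = cscale (of_real r) A"
  by (simp add: cscale_def vec_eq_iff scaleR_conv_of_real[where 'a = complex])

lemma cscale_minus: "cscale (- c) A = - cscale c A"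
  by (simp add: cscale_def vec_eq_iff)

lemma mat_adj_cscale: "mat_adj (cscale c A) = cscale (cnj c) (mat_adj A)"
  by (simp add: cscale_def mat_adj_def vec_eq_iff)

lemma mat_adj_mat_1: "mat_adj (mat 1) = mat 1"
  by (auto simp: mat_adj_def mat_def vec_eq_iff)

text \<open>Bilinear maps on finite-dimensional spaces are bounded; this makes the product rule
  available for \<open>**\<close>.\<close>

lemma bounded_bilinear_matrix_mult:
  "bounded_bilinear ((**) :: complex^'n^'m \<Rightarrow> complex^'k^'n \<Rightarrow> complex^'k^'m)"
  unfolding bilinear_conv_bounded_bilinear[symmetric] bilinear_def
  by (auto intro!: linearI
      simp: vec_eq_iff matrix_matrix_mult_def sum.distrib scaleR_sum_right algebra_simps)

text \<open>The adjoint is conjugate-linear over the complex numbers but real-linear, which is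
  enough because all parameters are real.\<close>

lemma bounded_linear_mat_adj: "bounded_linear (mat_adj :: complex^'n^'m \<Rightarrow> complex^'m^'n)"
  unfolding linear_conv_bounded_linear[symmetric]
  by (auto intro!: linearI simp: vec_eq_iff mat_adj_def)

lemma bounded_linear_trace_mult:
  "bounded_linear (\<lambda>X :: complex^'n^'n. Re (trace (A ** X)))"
  unfolding linear_conv_bounded_linear[symmetric]
  by (auto intro!: linearI
      simp: trace_def matrix_matrix_mult_def sum.distrib sum_subtractf sum_distrib_left algebra_simps)

lemmas has_derivative_matrix_mult = bounded_bilinear.FDERIV[OF bounded_bilinear_matrix_mult]
lemmas has_derivative_mat_adj = bounded_linear.has_derivative[OF bounded_linear_mat_adj]

lemma has_vector_derivative_vec:
  fixes f :: "real \<Rightarrow> 'a::real_normed_vector^'n"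
  assumes "\<And>i. ((\<lambda>x. f x $ i) has_vector_derivative f' $ i) F"
  shows "(f has_vector_derivative f') F"
  using assms unfolding has_vector_derivative_def has_derivative_def
  by (auto intro!: vec_tendstoI bounded_linear_scaleR_left)

section \<open>The matrix exponential: convergence, derivative, unitarity\<close>

text \<open>Left multiplication by \<open>A\<close> is bounded by some \<open>K\<close>, so the
  terms are dominated by a multiple of the exponential series of \<open>K\<close>.\<close>

lemma summable_mat_exp:
  fixes A :: "complex^'n^'n"
  shows "summable (\<lambda>k. (1 / fact k) *\<^sub>R (((**) A ^^ k) (mat 1)))"
proof -
  obtain K where K: "K > 0" "\<And>X :: complex^'n^'n. norm (A ** X) \<le> norm X * K"
    using bounded_linear.pos_bounded[OF bounded_bilinear.bounded_linear_right[OF bounded_bilinear_matrix_mult]]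
    by blast
  have *: "norm (((**) A ^^ k) (mat 1)) \<le> K ^ k * norm (mat 1 :: complex^'n^'n)" for k
  proof (induction k)
    case (Suc k)
    have "norm (((**) A ^^ Suc k) (mat 1)) \<le> norm (((**) A ^^ k) (mat 1)) * K"
      using K(2) by simp
    also have "\<dots> \<le> (K ^ k * norm (mat 1 :: complex^'n^'n)) * K"
      using Suc K(1) by (intro mult_right_mono) auto
    finally show ?case by (simp add: mult_ac)
  qed simp
  show ?thesis
  proof (rule summable_comparison_test')
    show "summable (\<lambda>k. norm (mat 1 :: complex^'n^'n) * (inverse (fact k) * K ^ k))"
      by (intro summable_mult summable_exp)
    show "norm ((1 / fact k) *\<^sub>R (((**) A ^^ k) (mat 1)))
        \<le> norm (mat 1 :: complex^'n^'n) * (inverse (fact k) * K ^ k)" if "k \<ge> 0" for k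
      using mult_left_mono[OF *[of k], of "inverse (fact k)"]
      by (simp add: field_simps)
  qed
qed

lemma exp_term_component:
  fixes X :: "complex^'n^'m"
  shows "((1 / fact k) *\<^sub>R X) $ a $ b = X $ a $ b / fact k"
  by (simp add: scaleR_conv_of_real[where 'a = complex])

lemma mat_exp_component:
  fixes A :: "complex^'n^'n"
  shows "mat_exp A $ a $ b = (\<Sum>k. (((**) A ^^ k) (mat 1)) $ a $ b / fact k)"
proof -
  have "bounded_linear (\<lambda>X :: complex^'n^'n. X $ a $ b)"
    by (rule bounded_linear_compose[OF bounded_linear_vec_nth bounded_linear_vec_nth])
  from bounded_linear.suminf[OF this summable_mat_exp[of A]] show ?thesis
    by (simp only: mat_exp_def exp_term_component)
qed

lemma summable_mat_exp_component:
  fixes A :: "complex^'n^'n"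
  shows "summable (\<lambda>k. (((**) A ^^ k) (mat 1 :: complex^'n^'n)) $ a $ b / fact k)"
proof -
  have "bounded_linear (\<lambda>X :: complex^'n^'n. X $ a $ b)"
    by (rule bounded_linear_compose[OF bounded_linear_vec_nth bounded_linear_vec_nth])
  from bounded_linear.summable[OF this summable_mat_exp[of A]] show ?thesis
    by (simp only: exp_term_component)
qed

lemma matrix_power_cscale:
  fixes A :: "complex^'n^'n"
  shows "((**) (cscale z A) ^^ k) (mat 1) = cscale (z ^ k) (((**) A ^^ k) (mat 1))"
proof (induction k)
  case (Suc k)
  have "((**) (cscale z A) ^^ Suc k) (mat 1) = cscale z (A ** cscale (z ^ k) (((**) A ^^ k) (mat 1)))"
    by (simp only: funpow.simps o_apply Suc.IH cscale_mult_left)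
  also have "\<dots> = cscale (z ^ Suc k) (((**) A ^^ Suc k) (mat 1))"
    by (simp add: cscale_mult_right) (simp add: cscale_def vec_eq_iff mult.assoc)
  finally show ?case .
qed (simp add: cscale_def vec_eq_iff)

text \<open>Each entry of \<open>mat_exp (cscale z A)\<close> is an everywhere convergent power
  series in the complex variable \<open>z\<close>. It is differentiated termwise, and the derivative
  is then restricted to the real line.\<close>

lemma has_vector_derivative_mat_exp:
  fixes A :: "complex^'n^'n"
  shows "((\<lambda>s. mat_exp (s *\<^sub>R A)) has_vector_derivative A ** mat_exp (s *\<^sub>R A)) (at s)"
proof (intro has_vector_derivative_vec)
  fix a b
  define P where "P k = ((**) A ^^ k) (mat 1)" for k
  define c where "c k = P k $ a $ b / fact k" for k
  have power: "((**) (cscale z A) ^^ k) (mat 1) $ i $ b = P k $ i $ b * z ^ k" for z k i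
    unfolding matrix_power_cscale by (simp add: P_def cscale_def mult.commute)
  have exp_eq: "mat_exp (cscale z A) $ i $ b = (\<Sum>k. P k $ i $ b / fact k * z ^ k)" for z i
    by (simp add: mat_exp_component power)
  \<comment> \<open>All rows \<open>i\<close> of column \<open>b\<close> are covered, since the
    factor \<open>A\<close> in the derivative mixes them.\<close>
  have summ: "summable (\<lambda>k. P k $ i $ b / fact k * z ^ k)" for z i
    using summable_mat_exp_component[of "cscale z A" i b]
    by (simp add: power)
  have "((\<lambda>z. \<Sum>k. c k * z ^ k) has_field_derivative (\<Sum>k. diffs c k * of_real s ^ k))
          (at (of_real s))"
    by (rule termdiffs_strong_converges_everywhere) (use summ in \<open>simp add: c_def\<close>)
  also have "(\<lambda>z. \<Sum>k. c k * z ^ k) = (\<lambda>z. mat_exp (cscale z A) $ a $ b)"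
    by (simp add: exp_eq c_def)
  also have "(\<Sum>k. diffs c k * of_real s ^ k)
      = (\<Sum>k. \<Sum>i\<in>UNIV. A $ a $ i * (P k $ i $ b / fact k * of_real s ^ k))"
  proof (rule arg_cong[where f = suminf], rule ext)
    fix k
    \<comment> \<open>\<open>diffs\<close> shifts the index: its factor k + 1 reduces (k + 1)! to
      k!, and the power of index k + 1 is \<open>A\<close> times that of index k.\<close>
    have "diffs c k = P (Suc k) $ a $ b / fact k"
      by (simp add: diffs_def c_def divide_simps del: of_nat_Suc)
    then show "diffs c k * of_real s ^ k
        = (\<Sum>i\<in>UNIV. A $ a $ i * (P k $ i $ b / fact k * of_real s ^ k))"
      by (simp add: P_def matrix_matrix_mult_def sum_distrib_right sum_divide_distrib mult.assoc)
  qed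
  also have "\<dots> = (\<Sum>i\<in>UNIV. A $ a $ i * (\<Sum>k. P k $ i $ b / fact k * of_real s ^ k))"
    by (subst suminf_sum[OF summable_mult[OF summ]]) (simp only: suminf_mult[OF summ])
  also have "\<dots> = (A ** mat_exp (s *\<^sub>R A)) $ a $ b"
    by (simp add: matrix_matrix_mult_def scaleR_eq_cscale exp_eq)
  finally show "((\<lambda>s. mat_exp (s *\<^sub>R A) $ a $ b) has_vector_derivative
      (A ** mat_exp (s *\<^sub>R A)) $ a $ b) (at s)"
    unfolding scaleR_eq_cscale by (rule has_vector_derivative_real_field)
qed

lemma mat_exp_0: "mat_exp 0 = (mat 1 :: complex^'n^'n)"
proof -
  have "((**) 0 ^^ k) (mat 1 :: complex^'n^'n) = (if k = 0 then mat 1 else 0)" for k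
    by (cases k) auto
  then have "mat_exp 0 = (\<Sum>k. if k = 0 then (mat 1 :: complex^'n^'n) else 0)"
    unfolding mat_exp_def by (intro arg_cong[where f = suminf] ext) simp
  also have "\<dots> = mat 1"
    by (subst suminf_finite[of "{0}"]) auto
  finally show ?thesis .
qed

text \<open>The derivative of \<open>s \<mapsto> e\<^bsup>sA\<^esup>\<^sup>\<dagger> e\<^bsup>sA\<^esup>\<close> vanishes for anti-Hermitian \<open>A\<close>.\<close>

lemma mat_exp_unitary:
  fixes A :: "complex^'n^'n"
  assumes "mat_adj A = - A"
  shows "mat_adj (mat_exp (s *\<^sub>R A)) ** mat_exp (s *\<^sub>R A) = mat 1"
proof -
  let ?E = "\<lambda>s. mat_exp (s *\<^sub>R A)"
  have "((\<lambda>s. mat_adj (?E s) ** ?E s) has_derivative (\<lambda>h. 0)) (at s)" for s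
  proof (rule has_derivative_eq_rhs)
    have D: "(?E has_derivative (\<lambda>h. h *\<^sub>R (A ** ?E s))) (at s)"
      using has_vector_derivative_mat_exp[of A s] by (simp add: has_vector_derivative_def)
    show "((\<lambda>s. mat_adj (?E s) ** ?E s) has_derivative
        (\<lambda>h. mat_adj (?E s) ** (h *\<^sub>R (A ** ?E s)) + mat_adj (h *\<^sub>R (A ** ?E s)) ** ?E s)) (at s)"
      by (rule has_derivative_matrix_mult[OF has_derivative_mat_adj[OF D] D])
    \<comment> \<open>The adjoint of \<open>A ** ?E s\<close> is minus
      \<open>mat_adj (?E s) ** A\<close>, so the two summands cancel.\<close>
    show "(\<lambda>h. mat_adj (?E s) ** (h *\<^sub>R (A ** ?E s)) + mat_adj (h *\<^sub>R (A ** ?E s)) ** ?E s)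
        = (\<lambda>h. 0)"
      by (simp add: linear_cmul[OF bounded_linear.linear[OF bounded_linear_mat_adj]]
          bounded_bilinear.scaleR_left[OF bounded_bilinear_matrix_mult]
          bounded_bilinear.scaleR_right[OF bounded_bilinear_matrix_mult]
          bounded_bilinear.minus_left[OF bounded_bilinear_matrix_mult]
          bounded_bilinear.minus_right[OF bounded_bilinear_matrix_mult]
          mat_adj_mult assms matrix_mul_assoc)
  qed
  \<comment> \<open>The constant is identified by evaluating at 0, where the exponential is the
    identity.\<close>
  then obtain C where "\<And>s. mat_adj (?E s) ** ?E s = C"
    using has_derivative_zero_constant[of UNIV "\<lambda>s. mat_adj (?E s) ** ?E s"] by auto
  from this[of s] this[of 0] show ?thesis
    by (simp add: mat_exp_0 mat_adj_mat_1)
qed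

section \<open>Differentiating the circuit layer by layer\<close>

text \<open>The ansatz over an arbitrary list of layers, to allow induction on the list; appending a
  layer multiplies the circuit from the left.\<close>

definition layers ::
  "complex^'d^'d \<Rightarrow> complex^'d^'d \<Rightarrow> ('p \<Rightarrow> complex^'d^'d) \<Rightarrow> 'p list \<Rightarrow>
   real^'p \<Rightarrow> complex^'d^'d" where
  "layers H U\<^sub>0 U ls \<theta> =
     fold (\<lambda>l V. U l ** mat_exp (cscale (- \<i> * of_real (\<theta> $ l)) H) ** V) ls U\<^sub>0"

text \<open>The exponent is rewritten as a real parameter times the fixed generator -iH, the form in
  which the derivative and the unitarity of the exponential are available.\<close>

lemma layers_snoc:
  "layers H U\<^sub>0 U (ls @ [l]) \<theta> = U l ** mat_exp (\<theta> $ l *\<^sub>R cscale (- \<i>) H) ** layers H U\<^sub>0 U ls \<theta>"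
proof -
  have "cscale (- \<i> * of_real r) H = r *\<^sub>R cscale (- \<i>) H" for r
    by (simp add: scaleR_eq_cscale) (simp add: cscale_def vec_eq_iff)
  then show ?thesis by (simp add: layers_def)
qed

lemma mat_adj_generator: "hermitian H \<Longrightarrow> mat_adj (cscale (- \<i>) H) = - cscale (- \<i>) H"
  by (simp add: cscale_minus[symmetric] mat_adj_cscale hermitian_def)

lemma layers_unitary:
  assumes H: "hermitian H" and U: "U\<^sub>0 \<in> SU" "\<And>l. U l \<in> SU"
  shows "mat_adj (layers H U\<^sub>0 U ls \<theta>) ** layers H U\<^sub>0 U ls \<theta> = mat 1"
proof (induction ls rule: rev_induct)
  case Nil
  then show ?case using U by (simp add: layers_def SU_def)
next
  case (snoc l ls)
  let ?E = "mat_exp (\<theta> $ l *\<^sub>R cscale (- \<i>) H)" and ?F = "layers H U\<^sub>0 U ls \<theta>"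
  have "mat_adj (layers H U\<^sub>0 U (ls @ [l]) \<theta>) ** layers H U\<^sub>0 U (ls @ [l]) \<theta>
      = mat_adj ?F ** (mat_adj ?E ** (mat_adj (U l) ** U l) ** ?E) ** ?F"
    by (simp add: layers_snoc mat_adj_mult matrix_mul_assoc)
  also have "mat_adj (U l) ** U l = mat 1"
    using U(2)[of l] by (simp add: SU_def)
  finally show ?case
    using snoc mat_exp_unitary[OF mat_adj_generator[OF H]] by simp
qed

text \<open>Inserting \<open>F F\<^sup>\<dagger> = 1\<close> moves every generator to the right of the whole circuit; there it is
  conjugated by the part of the circuit preceding its layer.\<close>

lemma has_derivative_layers:
  fixes H U\<^sub>0 :: "complex^'d^'d" and U :: "'p::finite \<Rightarrow> complex^'d^'d"
  assumes H: "hermitian H" and U: "U\<^sub>0 \<in> SU" "\<And>l. U l \<in> SU"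
  shows "\<exists>G. (\<forall>l. hermitian (G l)) \<and>
    (layers H U\<^sub>0 U ls has_derivative
      (\<lambda>h. layers H U\<^sub>0 U ls \<theta> ** cscale (- \<i>) (\<Sum>l\<in>UNIV. h $ l *\<^sub>R G l))) (at \<theta>)"
proof (induction ls rule: rev_induct)
  case Nil
  have "layers H U\<^sub>0 U [] = (\<lambda>_. U\<^sub>0)" by (simp add: fun_eq_iff layers_def)
  then show ?case
    \<comment> \<open>Without layers the circuit is constant, so all generators vanish.\<close>
    by (intro exI[of _ "\<lambda>_. 0"])
       (auto simp: hermitian_def mat_adj_def vec_eq_iff cscale_def matrix_matrix_mult_def
         simp flip: zero_vec_def)
next
  case (snoc x ls)
  then obtain G where G: "\<And>l. hermitian (G l)"
    and D: "(layers H U\<^sub>0 U ls has_derivative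
      (\<lambda>h. layers H U\<^sub>0 U ls \<theta> ** cscale (- \<i>) (\<Sum>l\<in>UNIV. h $ l *\<^sub>R G l))) (at \<theta>)" by blast
  let ?A = "cscale (- \<i>) H" and ?F = "layers H U\<^sub>0 U ls"
  let ?E = "\<lambda>\<theta>. mat_exp (\<theta> $ x *\<^sub>R ?A)"
  \<comment> \<open>The new layer adds its own conjugate of \<open>H\<close>; adding rather than
    replacing also covers a repeated index \<open>x\<close>. The conjugation includes the layer's
    own exponential because its derivative has the generator on the left of
    \<open>?E\<close>.\<close>
  define G' where "G' l = G l + (if l = x then mat_adj (?E \<theta> ** ?F \<theta>) ** H ** (?E \<theta> ** ?F \<theta>) else 0)" for l
  have herm: "hermitian (G' l)" for l
    using G[of l] H
    by (auto simp: G'_def hermitian_def mat_adj_mult mat_adj_mat_adj matrix_mul_assoc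
        linear_0[OF bounded_linear.linear[OF bounded_linear_mat_adj]]
        linear_add[OF bounded_linear.linear[OF bounded_linear_mat_adj]])
  \<comment> \<open>Unitarity gives a left inverse; for square matrices it is also a right inverse,
    which is the order that collapses below.\<close>
  have "mat_adj (?E \<theta> ** ?F \<theta>) ** (?E \<theta> ** ?F \<theta>)
      = mat_adj (?F \<theta>) ** (mat_adj (?E \<theta>) ** ?E \<theta>) ** ?F \<theta>"
    by (simp add: mat_adj_mult matrix_mul_assoc)
  also have "\<dots> = mat 1"
    by (simp add: mat_exp_unitary[OF mat_adj_generator[OF H]] layers_unitary[OF H U])
  finally have inv: "(?E \<theta> ** ?F \<theta>) ** mat_adj (?E \<theta> ** ?F \<theta>) = mat 1"
    by (simp add: matrix_left_right_inverse)
  have E: "(?E has_derivative (\<lambda>h. h $ x *\<^sub>R (?A ** ?E \<theta>))) (at \<theta>)"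
    using has_derivative_compose[OF bounded_linear_imp_has_derivative[OF bounded_linear_vec_nth]
      has_vector_derivative_mat_exp[unfolded has_vector_derivative_def]] .
  have UE: "((\<lambda>\<theta>. U x ** ?E \<theta>) has_derivative (\<lambda>h. U x ** (h $ x *\<^sub>R (?A ** ?E \<theta>)))) (at \<theta>)"
    by (rule bounded_linear.has_derivative[OF
      bounded_bilinear.bounded_linear_right[OF bounded_bilinear_matrix_mult] E])
  have "(layers H U\<^sub>0 U (ls @ [x]) has_derivative
      (\<lambda>h. U x ** ?E \<theta> ** (?F \<theta> ** cscale (- \<i>) (\<Sum>l\<in>UNIV. h $ l *\<^sub>R G l))
         + U x ** (h $ x *\<^sub>R (?A ** ?E \<theta>)) ** ?F \<theta>)) (at \<theta>)"
    using has_derivative_matrix_mult[OF UE D] by (simp add: layers_snoc[abs_def])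
  moreover have "U x ** ?E \<theta> ** (?F \<theta> ** cscale (- \<i>) (\<Sum>l\<in>UNIV. h $ l *\<^sub>R G l))
         + U x ** (h $ x *\<^sub>R (?A ** ?E \<theta>)) ** ?F \<theta>
      = layers H U\<^sub>0 U (ls @ [x]) \<theta> ** cscale (- \<i>) (\<Sum>l\<in>UNIV. h $ l *\<^sub>R G' l)" for h
  proof -
    have sum: "(\<Sum>l\<in>UNIV. h $ l *\<^sub>R G' l)
        = (\<Sum>l\<in>UNIV. h $ l *\<^sub>R G l) + h $ x *\<^sub>R (mat_adj (?E \<theta> ** ?F \<theta>) ** H ** (?E \<theta> ** ?F \<theta>))"
      by (simp add: G'_def scaleR_add_right sum.distrib if_distrib[where f = "scaleR _"]
          cong: if_cong)
    have "U x ** (?E \<theta> ** ?F \<theta>) ** cscale (- \<i>) (mat_adj (?E \<theta> ** ?F \<theta>) ** H ** (?E \<theta> ** ?F \<theta>))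
        = U x ** cscale (- \<i>) ((?E \<theta> ** ?F \<theta> ** mat_adj (?E \<theta> ** ?F \<theta>)) ** H ** (?E \<theta> ** ?F \<theta>))"
      by (simp only: cscale_mult_right matrix_mul_assoc)
    also have "\<dots> = U x ** (?A ** ?E \<theta>) ** ?F \<theta>"
      by (simp add: inv cscale_mult_left cscale_mult_right matrix_mul_assoc)
    finally have "U x ** (?E \<theta> ** ?F \<theta>) ** cscale (- \<i>) (mat_adj (?E \<theta> ** ?F \<theta>) ** H ** (?E \<theta> ** ?F \<theta>))
        = U x ** (?A ** ?E \<theta>) ** ?F \<theta>" .
    then show ?thesis
      unfolding sum cscale_add cscale_scaleR layers_snoc
      by (simp only: matrix_add_ldistrib matrix_mul_assoc
          bounded_bilinear.scaleR_left[OF bounded_bilinear_matrix_mult]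
          bounded_bilinear.scaleR_right[OF bounded_bilinear_matrix_mult])
  qed
  ultimately show ?case using herm by auto
qed

section \<open>The derivative of the evolved observable\<close>

text \<open>Serves to pull the weighted sum over the layers out of the commutator.\<close>

lemma linear_icomm_left:
  fixes B :: "complex^'n^'n"
  shows "linear (\<lambda>A. icomm A B)"
proof (rule linearI)
  fix A A' :: "complex^'n^'n" and r :: real
  have "icomm (A + A') B = cscale \<i> ((A ** B - B ** A) + (A' ** B - B ** A'))"
    by (simp add: icomm_def bounded_bilinear.add_left[OF bounded_bilinear_matrix_mult]
        bounded_bilinear.add_right[OF bounded_bilinear_matrix_mult] add_diff_add)
  then show "icomm (A + A') B = icomm A B + icomm A' B"
    by (simp only: cscale_add icomm_def)
  have "icomm (r *\<^sub>R A) B = cscale \<i> (r *\<^sub>R (A ** B - B ** A))"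
    by (simp only: icomm_def bounded_bilinear.scaleR_left[OF bounded_bilinear_matrix_mult]
        bounded_bilinear.scaleR_right[OF bounded_bilinear_matrix_mult] scaleR_diff_right)
  then show "icomm (r *\<^sub>R A) B = r *\<^sub>R icomm A B"
    by (simp only: cscale_scaleR icomm_def)
qed

text \<open>If the circuit F has derivative F(-iS) with S Hermitian, its adjoint has derivative iS
  times the adjoint of F. The product rule then yields i(SM - MS).\<close>

lemma has_derivative_evolved:
  fixes M\<^sub>0 H U\<^sub>0 :: "complex^'d^'d" and U :: "'p::{finite,linorder} \<Rightarrow> complex^'d^'d"
  assumes H: "hermitian H" and U: "U\<^sub>0 \<in> SU" "\<And>l. U l \<in> SU"
  shows "\<exists>G. (\<forall>l. hermitian (G l)) \<and>
    (evolved M\<^sub>0 H U\<^sub>0 U has_derivative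
      (\<lambda>h. \<Sum>l\<in>UNIV. h $ l *\<^sub>R icomm (G l) (evolved M\<^sub>0 H U\<^sub>0 U \<theta>))) (at \<theta>)"
proof -
  define F where "F = ansatz H U\<^sub>0 U"
  have F: "F = layers H U\<^sub>0 U (sorted_list_of_set UNIV)"
    by (simp add: fun_eq_iff F_def ansatz_def layers_def)
  have "\<exists>G. (\<forall>l. hermitian (G l)) \<and>
      (F has_derivative (\<lambda>h. F \<theta> ** cscale (- \<i>) (\<Sum>l\<in>UNIV. h $ l *\<^sub>R G l))) (at \<theta>)"
    unfolding F by (rule has_derivative_layers[OF H U])
  then obtain G where G: "\<And>l. hermitian (G l)"
    and D: "(F has_derivative (\<lambda>h. F \<theta> ** cscale (- \<i>) (\<Sum>l\<in>UNIV. h $ l *\<^sub>R G l))) (at \<theta>)"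
    by blast
  have M: "evolved M\<^sub>0 H U\<^sub>0 U = (\<lambda>\<theta>. mat_adj (F \<theta>) ** (M\<^sub>0 ** F \<theta>))"
    by (simp add: fun_eq_iff evolved_def F_def matrix_mul_assoc)
  define S where "S h = (\<Sum>l\<in>UNIV. h $ l *\<^sub>R G l)" for h :: "real^'p::_"
  have S: "mat_adj (S h) = S h" for h
    using G by (simp add: S_def linear_sum[OF bounded_linear.linear[OF bounded_linear_mat_adj]]
        linear_cmul[OF bounded_linear.linear[OF bounded_linear_mat_adj]] hermitian_def)
  have "(evolved M\<^sub>0 H U\<^sub>0 U has_derivative
      (\<lambda>h. mat_adj (F \<theta>) ** (M\<^sub>0 ** (F \<theta> ** cscale (- \<i>) (S h)))
         + mat_adj (F \<theta> ** cscale (- \<i>) (S h)) ** (M\<^sub>0 ** F \<theta>))) (at \<theta>)"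
    unfolding M S_def
    by (intro has_derivative_matrix_mult has_derivative_mat_adj D bounded_linear.has_derivative[OF
      bounded_bilinear.bounded_linear_right[OF bounded_bilinear_matrix_mult]])
  \<comment> \<open>Applied with X = MS, from differentiating F, and Y = SM, from differentiating
    its adjoint.\<close>
  moreover have "cscale (- \<i>) X + cscale (cnj (- \<i>)) Y = cscale \<i> (Y - X)" for X Y :: "complex^'d^'d"
    by (simp add: cscale_def vec_eq_iff algebra_simps)
  then have "mat_adj (F \<theta>) ** (M\<^sub>0 ** (F \<theta> ** cscale (- \<i>) (S h)))
         + mat_adj (F \<theta> ** cscale (- \<i>) (S h)) ** (M\<^sub>0 ** F \<theta>)
      = icomm (S h) (evolved M\<^sub>0 H U\<^sub>0 U \<theta>)" for h
    unfolding mat_adj_mult mat_adj_cscale S M cscale_mult_left cscale_mult_right matrix_mul_assoc icomm_def .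
  moreover have "icomm (S h) X = (\<Sum>l\<in>UNIV. h $ l *\<^sub>R icomm (G l) X)" for h X
    by (simp add: S_def linear_sum[OF linear_icomm_left] linear_cmul[OF linear_icomm_left])
  ultimately have "(evolved M\<^sub>0 H U\<^sub>0 U has_derivative
      (\<lambda>h. \<Sum>l\<in>UNIV. h $ l *\<^sub>R icomm (G l) (evolved M\<^sub>0 H U\<^sub>0 U \<theta>))) (at \<theta>)"
    by (simp only:)
  with G show ?thesis by blast
qed

section \<open>Trace identities for commutators, the swap operator and Kronecker products\<close>

text \<open>Cyclicity of the trace. With \<open>A\<close> a state, \<open>B\<close> a generator and
  \<open>C\<close> the observable, it moves the commutator from the generator onto the
  state.\<close>

lemma trace_mult_icomm:
  fixes A B C :: "complex^'n^'n"
  shows "trace (A ** icomm B C) = trace (icomm C A ** B)"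
proof -
  have "trace (A ** (B ** C)) = trace (C ** A ** B)"
    using trace_mul_sym[of "A ** B" C] by (simp add: matrix_mul_assoc)
  then have "trace (A ** (B ** C - C ** B)) = trace ((C ** A - A ** C) ** B)"
    by (simp add: bounded_bilinear.diff_left[OF bounded_bilinear_matrix_mult]
        bounded_bilinear.diff_right[OF bounded_bilinear_matrix_mult] trace_sub matrix_mul_assoc)
  moreover have "trace (cscale c X) = c * trace X" for c and X :: "complex^'n^'n"
    by (simp add: trace_def cscale_def sum_distrib_left)
  ultimately show ?thesis
    by (simp add: icomm_def cscale_mult_left cscale_mult_right)
qed

definition swap_matrix :: "complex^('d::finite \<times> 'd)^('d \<times> 'd)" where
  "swap_matrix = (\<chi> r c. if c = (snd r, fst r) then 1 else 0)"

lemma sum_UNIV_prod: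
  "(\<Sum>x\<in>(UNIV :: ('a::finite \<times> 'b::finite) set). f x) = (\<Sum>a\<in>UNIV. \<Sum>b\<in>UNIV. f (a, b))"
  by (simp add: sum.cartesian_product)

lemma hermitian_swap_matrix: "hermitian (swap_matrix :: complex^('d::finite \<times> 'd)^('d \<times> 'd))"
  by (auto simp: hermitian_def mat_adj_def swap_matrix_def vec_eq_iff)

text \<open>The swap trick: on each diagonal entry of the product only one summand survives, the one
  with exchanged indices.\<close>

lemma trace_kron_swap_matrix: "trace (kron A B ** swap_matrix) = trace (A ** B)"
proof -
  have "A $ a $ fst r * B $ b $ snd r * swap_matrix $ r $ (a, b)
      = (if r = (b, a) then A $ a $ b * B $ b $ a else 0)" for a b r
    by (cases r) (auto simp: swap_matrix_def)
  then have "(kron A B ** swap_matrix) $ (a, b) $ (a, b) = A $ a $ b * B $ b $ a" for a b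
    by (simp add: matrix_matrix_mult_def kron_def)
  then show ?thesis
    by (simp add: trace_def sum_UNIV_prod matrix_matrix_mult_def)
qed

lemma trace_kron_kron: "trace (kron A B ** kron C D) = trace (A ** C) * trace (B ** D)"
proof -
  have "(kron A B ** kron C D) $ (a, b) $ (a, b) = (A ** C) $ a $ a * (B ** D) $ b $ b" for a b
    by (simp add: matrix_matrix_mult_def kron_def sum_UNIV_prod sum_product mult_ac)
  then show ?thesis
    by (simp add: trace_def sum_UNIV_prod sum_product)
qed

section \<open>Gradient of the loss\<close>

text \<open>Derivatives are unique, and testing against the difference of two candidate gradients
  forces them to coincide.\<close>

lemma gradient_eq:
  assumes "GDERIV f x :> g"
  shows "gradient f x = g"
  unfolding gradient_def
proof (rule the_equality)
  show "GDERIV f x :> g" by (rule assms)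
next
  fix g' assume "GDERIV f x :> g'"
  then have "(\<lambda>h. inner h g') = (\<lambda>h. inner h g)"
    using assms unfolding gderiv_def by (rule has_derivative_unique)
  then have "inner (g' - g) g' = inner (g' - g) g" by meson
  then have "inner (g' - g) (g' - g) = 0" by (simp add: inner_diff_right)
  then show "g' = g" by simp
qed

text \<open>As a multiple of a squared norm, the loss can be differentiated by the product rule for
  \<open>inner\<close>.\<close>

lemma loss_residual: "loss \<rho> y X = (1 / (2 * real CARD('m))) * inner (residual \<rho> y X) (residual \<rho> y X)"
  for y :: "real^'m::finite"
  by (simp add: loss_def residual_def inner_vec_def power2_eq_square algebra_simps)

section \<open>The perturbation and the kernel of the residual dynamics\<close>

text \<open>The theorem takes \<open>c\<close> to be \<eta>/m: \<eta> comes from the flow and 1/m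
  from the gradient of the loss.\<close>

definition perturbation :: "real \<Rightarrow> ('p::finite \<Rightarrow> complex^'d^'d) \<Rightarrow> complex^('d \<times> 'd)^('d \<times> 'd)" where
  "perturbation c G = c *\<^sub>R (\<Sum>l\<in>UNIV. kron (G l) (G l)) - swap_matrix"

lemma hermitian_perturbation:
  fixes G :: "'p::finite \<Rightarrow> complex^'d^'d"
  assumes "\<And>l. hermitian (G l)"
  shows "hermitian (perturbation c G)"
proof -
  have "linear (mat_adj :: complex^('d \<times> 'd)^('d \<times> 'd) \<Rightarrow> _)"
    by (rule bounded_linear.linear[OF bounded_linear_mat_adj])
  then show ?thesis
    using hermitian_kron[OF assms assms] hermitian_swap_matrix
    unfolding hermitian_def perturbation_def
    by (simp add: linear_diff linear_cmul linear_sum)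
qed

text \<open>By the swap trick the subtracted swap operator contributes minus the entry of
  \<open>K_asym\<close>; the two cancel and only the tensor squares of the generators
  remain.\<close>

lemma K_asym_plus_K_pert:
  fixes \<rho> :: "'m::finite \<Rightarrow> complex^'d^'d" and G :: "'p::finite \<Rightarrow> complex^'d^'d"
  assumes "hermitian M" "\<And>j. hermitian (\<rho> j)" "\<And>l. hermitian (G l)"
  shows "(K_asym \<rho> M + K_pert \<rho> M (perturbation c G)) $ i $ j
    = c * (\<Sum>l\<in>UNIV. Re (trace (icomm M (\<rho> i) ** G l)) * Re (trace (icomm M (\<rho> j) ** G l)))"
proof -
  let ?C = "\<lambda>j. icomm M (\<rho> j)"
  have lin: "linear (\<lambda>X. Re (trace (kron (?C i) (?C j) ** X)))"
    by (rule bounded_linear.linear[OF bounded_linear_trace_mult])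
  \<comment> \<open>Both factors are Hermitian, so the traces are real and \<open>Re\<close> of
    their product splits.\<close>
  have "Im (trace (?C k ** G l)) = 0" for k l
    using trace_mult_hermitian_real[OF hermitian_icomm] assms complex_is_Real_iff by blast
  then have "Re (trace (kron (?C i) (?C j) ** kron (G l) (G l)))
      = Re (trace (?C i ** G l)) * Re (trace (?C j ** G l))" for l
    by (simp add: trace_kron_kron)
  then show ?thesis
    by (simp add: K_asym_def K_pert_def perturbation_def linear_diff[OF lin] linear_cmul[OF lin]
        linear_sum[OF lin] trace_kron_swap_matrix)
qed

section \<open>Residual dynamics along the gradient flow\<close>

theorem lemma4p1:
  fixes \<rho> :: "'m::finite \<Rightarrow> complex^'d^'d"
    and y :: "real^'m"
    and M\<^sub>0 H U\<^sub>0 :: "complex^'d^'d"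
    and U :: "'p::{finite,linorder} \<Rightarrow> complex^'d^'d"
    and M :: "real^'p::_ \<Rightarrow> complex^'d^'d"
    and L :: "real^'p::_ \<Rightarrow> real"
    and \<eta> :: real
  assumes "\<And>j. quantum_state (\<rho> j)"
    and "hermitian M\<^sub>0"
    and "hermitian H" and "H \<noteq> 0" and "trace H = 0"
    and "U\<^sub>0 \<in> SU" and "\<And>l. U l \<in> SU"
  defines "M \<equiv> evolved M\<^sub>0 H U\<^sub>0 U"
    and "L \<equiv> \<lambda>\<theta>. loss \<rho> y (M \<theta>)"
    and "\<eta> \<equiv> real CARD('m) / real CARD('p) * ((real CARD('d))\<^sup>2 - 1) / Re (trace (H ** H))"
  shows "\<exists>\<Delta> :: real^'p::_ \<Rightarrow> complex^('d \<times> 'd)^('d \<times> 'd).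
    (\<forall>\<theta>. hermitian (\<Delta> \<theta>)) \<and>
    (\<forall>\<theta> :: real \<Rightarrow> real^'p::_. gradient_flow \<eta> L \<theta> \<longrightarrow>
      (\<forall>t\<ge>0. ((\<lambda>s. residual \<rho> y (M (\<theta> s))) has_vector_derivative
         - ((K_asym \<rho> (M (\<theta> t)) + K_pert \<rho> (M (\<theta> t)) (\<Delta> (\<theta> t)))
             *v residual \<rho> y (M (\<theta> t)))) (at t within {0..})))"
proof -
  let ?m = "real CARD('m)" and ?r = "\<lambda>\<theta>. residual \<rho> y (M \<theta>)"
  have \<rho>: "hermitian (\<rho> j)" for j
    using assms(1)[of j] by (simp add: quantum_state_def pos_semidef_def)
  have M: "hermitian (M \<theta>)" for \<theta>
    unfolding M_def by (rule hermitian_evolved[OF assms(2)])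
  have "\<forall>\<theta>. \<exists>G. (\<forall>l. hermitian (G l)) \<and>
      (M has_derivative (\<lambda>h. \<Sum>l\<in>UNIV. h $ l *\<^sub>R icomm (G l) (M \<theta>))) (at \<theta>)"
    unfolding M_def by (intro allI has_derivative_evolved assms)
  \<comment> \<open>The generators are fixed as functions of the parameter point before any flow is
    considered, so that \<open>\<Delta>\<close> is a map on parameter space.\<close>
  from choice[OF this] obtain G where G: "\<And>\<theta> l. hermitian (G \<theta> l)"
    and DM: "\<And>\<theta>. (M has_derivative (\<lambda>h. \<Sum>l\<in>UNIV. h $ l *\<^sub>R icomm (G \<theta> l) (M \<theta>))) (at \<theta>)"
    by blast
  \<comment> \<open>\<open>D \<theta> j l\<close> is the partial derivative of the j-th prediction
    in direction l; \<open>r'\<close> carries a minus sign because the residual subtracts the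
    prediction.\<close>
  define D where "D \<theta> j l = Re (trace (icomm (M \<theta>) (\<rho> j) ** G \<theta> l))" for \<theta> j l
  define r' where "r' \<theta> h = (\<chi> j. - (\<Sum>l\<in>UNIV. h $ l * D \<theta> j l))" for \<theta> and h :: "real^'p::_"
  have Dr: "(?r has_derivative r' \<theta>) (at \<theta>)" for \<theta>
  proof -
    let ?T = "\<lambda>X. \<chi> j. Re (trace (\<rho> j ** X))"
    have lin: "linear (\<lambda>X. Re (trace (\<rho> j ** X)))" for j
      by (rule bounded_linear.linear[OF bounded_linear_trace_mult])
    have "linear ?T"
      by (rule linearI) (simp_all add: vec_eq_iff linear_add[OF lin] linear_cmul[OF lin])
    then have "bounded_linear ?T" by (simp add: linear_conv_bounded_linear)
    then have "((\<lambda>\<theta>. y - ?T (M \<theta>)) has_derivative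
        (\<lambda>h. 0 - ?T (\<Sum>l\<in>UNIV. h $ l *\<^sub>R icomm (G \<theta> l) (M \<theta>)))) (at \<theta>)"
      by (intro has_derivative_diff has_derivative_const bounded_linear.has_derivative[OF _ DM])
    moreover have "(\<lambda>\<theta>. y - ?T (M \<theta>)) = ?r"
      by (simp add: residual_def vec_eq_iff fun_eq_iff)
    moreover have "0 - ?T (\<Sum>l\<in>UNIV. h $ l *\<^sub>R icomm (G \<theta> l) (M \<theta>)) = r' \<theta> h" for h
      by (simp add: r'_def D_def vec_eq_iff linear_sum[OF lin] linear_cmul[OF lin] trace_mult_icomm)
    ultimately show ?thesis by simp
  qed
  \<comment> \<open>Up to the factor 1/m this is the transposed Jacobian of the residual applied to
    the residual; the 2 from the square cancels the 1/2 in the loss.\<close>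
  define g where "g \<theta> = (\<chi> l. - (1 / ?m) * (\<Sum>k\<in>UNIV. ?r \<theta> $ k * D \<theta> k l))" for \<theta>
  have grad: "gradient L \<theta> = g \<theta>" for \<theta>
  proof (rule gradient_eq)
    have "(L has_derivative (\<lambda>h. 1 / (2 * ?m) * (inner (?r \<theta>) (r' \<theta> h) + inner (r' \<theta> h) (?r \<theta>)))) (at \<theta>)"
      unfolding L_def loss_residual
      by (intro has_derivative_mult_right has_derivative_inner Dr)
    moreover have "1 / (2 * ?m) * (inner (?r \<theta>) (r' \<theta> h) + inner (r' \<theta> h) (?r \<theta>)) = inner h (g \<theta>)" for h
    proof -
      have "inner (?r \<theta>) (r' \<theta> h) = - (\<Sum>k\<in>UNIV. \<Sum>l\<in>UNIV. ?r \<theta> $ k * (h $ l * D \<theta> k l))"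
        by (simp add: inner_vec_def r'_def sum_negf sum_distrib_left)
      also have "\<dots> = - (\<Sum>l\<in>UNIV. \<Sum>k\<in>UNIV. ?r \<theta> $ k * (h $ l * D \<theta> k l))"
        by (subst sum.swap) simp
      also have "\<dots> = ?m * inner h (g \<theta>)"
        by (simp add: g_def inner_vec_def sum_distrib_left sum_divide_distrib sum_negf mult_ac)
      finally show ?thesis by (simp add: inner_commute)
    qed
    ultimately show "GDERIV L \<theta> :> g \<theta>" by (simp add: gderiv_def)
  qed
  define \<Delta> where "\<Delta> \<theta> = perturbation (\<eta> / ?m) (G \<theta>)" for \<theta>
  \<comment> \<open>Inserting the velocity of the flow into \<open>r'\<close> composes the Jacobian
    with its transpose; the three minus signs, from \<open>r'\<close>, the flow and
    \<open>g\<close>, leave one.\<close>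
  have kernel: "r' \<theta> (- (\<eta> *\<^sub>R gradient L \<theta>))
      = - ((K_asym \<rho> (M \<theta>) + K_pert \<rho> (M \<theta>) (\<Delta> \<theta>)) *v ?r \<theta>)" for \<theta>
  proof -
    have "r' \<theta> (- (\<eta> *\<^sub>R gradient L \<theta>)) $ j
        = - (((K_asym \<rho> (M \<theta>) + K_pert \<rho> (M \<theta>) (\<Delta> \<theta>)) *v ?r \<theta>) $ j)" for j
    proof -
      have "r' \<theta> (- (\<eta> *\<^sub>R gradient L \<theta>)) $ j
          = - (\<Sum>l\<in>UNIV. \<Sum>k\<in>UNIV. \<eta> / ?m * (D \<theta> j l * D \<theta> k l) * ?r \<theta> $ k)"
        by (simp add: r'_def grad g_def sum_distrib_left sum_distrib_right sum_divide_distrib sum_negf mult_ac)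
      also have "\<dots> = - (\<Sum>k\<in>UNIV. \<Sum>l\<in>UNIV. \<eta> / ?m * (D \<theta> j l * D \<theta> k l) * ?r \<theta> $ k)"
        by (subst sum.swap) simp
      \<comment> \<open>The entries of the two kernels are kept as one sum, so that
        \<open>K_asym_plus_K_pert\<close> can rewrite it.\<close>
      also have "\<dots> = - (((K_asym \<rho> (M \<theta>) + K_pert \<rho> (M \<theta>) (\<Delta> \<theta>)) *v ?r \<theta>) $ j)"
        unfolding matrix_vector_mult_def \<Delta>_def
        by (simp add: K_asym_plus_K_pert[OF M \<rho> G] D_def sum_distrib_left sum_distrib_right
            del: vector_add_component)
      finally show ?thesis .
    qed
    then show ?thesis by (simp add: vec_eq_iff)
  qed
  have "((\<lambda>s. ?r (\<theta> s)) has_vector_derivative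
      - ((K_asym \<rho> (M (\<theta> t)) + K_pert \<rho> (M (\<theta> t)) (\<Delta> (\<theta> t))) *v ?r (\<theta> t))) (at t within {0..})"
    if "gradient_flow \<eta> L \<theta>" "t \<ge> 0" for \<theta> t
  proof -
    have "(\<theta> has_vector_derivative - (\<eta> *\<^sub>R gradient L (\<theta> t))) (at t within {0..})"
      using that by (simp add: gradient_flow_def)
    \<comment> \<open>The residual is differentiable on the whole parameter space, so the one-sided
      derivative of the flow at time 0 suffices for the chain rule.\<close>
    from vector_derivative_diff_chain_within[OF this has_derivative_at_withinI[OF Dr]]
    show ?thesis by (simp only: kernel o_def)
  qed
  moreover have "hermitian (\<Delta> \<theta>)" for \<theta>
    unfolding \<Delta>_def by (rule hermitian_perturbation[OF G])
  ultimately show ?thesis by (intro exI[of _ \<Delta>]) simp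
qed

end
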